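(* Let $d\in\mathbb{N}$, let $\sigma:\mathbb{N}\to\mathbb{R}$ be a nonincreasing zero sequence and let $\tau$ be the nonincreasing rearrangement of its $d$th tensor power. Let $\sigma(1)>\sigma(2)>0$ and assume that $\sigma(n)\le C\,n^{-s}$ for some $s,C>0$ and all $n\ge 2$. Then for any $n\in\{2,\dots,2^d\}$, $$\frac{\sigma(2)}{\sigma(1)}\cdot\left(\frac1n\right)^{\frac{\log(\sigma(1)/\sigma(2))}{\log\left(1+\frac{d}{\log_2 n}\right)}}\;\le\;\frac{\tau(n)}{\tau(1)}\;\le\;\left(\frac{\exp\left((C/\sigma(1))^{2/s}\right)}{n}\right)^{\frac{\log(\sigma(1)/\sigma(2))}{\log\left((\sigma(1)/\sigma(2))^{2/s}\,d\right)}}.$$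
   Context: $\mathbb{N}=\{1,2,\dots\}$, $\log$ is the natural logarithm, $\log_2$ the logarithm to base 2. A nonincreasing zero sequence is a nonincreasing sequence of real numbers converging to $0$. The $d$th tensor power of $\sigma$ is $\sigma_d:\mathbb{N}^d\to\mathbb{R}$, $\sigma_d(n_1,\dots,n_d)=\prod_{j=1}^d\sigma(n_j)$. Its nonincreasing rearrangement $\tau:\mathbb{N}\to\mathbb{R}$ is the nonincreasing zero sequence for which $\tau(n)$ is the $n$th largest value of $\sigma_d$, counted with multiplicity. *)

theory Defs
  imports Complex_Main "HOL-Library.FuncSet"
begin

text \<open>Sequences are indexed by \<open>{1, 2, \<dots>}\<close>; the value of a function \<open>nat \<Rightarrow> real\<close>
  at \<open>0\<close> is irrelevant throughout.\<close>

definition nonincreasing_zero_sequence :: "(nat \<Rightarrow> real) \<Rightarrow> bool" where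
  "nonincreasing_zero_sequence \<sigma> \<longleftrightarrow> antimono_on {1..} \<sigma> \<and> \<sigma> \<longlonglongrightarrow> 0"

definition multi_indices :: "nat \<Rightarrow> (nat \<Rightarrow> nat) set" where
  "multi_indices d = {1..d} \<rightarrow>\<^sub>E {1..}"

definition tensor_power :: "(nat \<Rightarrow> real) \<Rightarrow> nat \<Rightarrow> (nat \<Rightarrow> nat) \<Rightarrow> real" where
  "tensor_power \<sigma> d k = (\<Prod>j=1..d. \<sigma> (k j))"

text \<open>\<open>v\<close> is the \<open>n\<close>th largest value of the family \<open>(f i)\<^sub>i\<^sub>\<in>\<^sub>I\<close>, counted with multiplicity:
  fewer than \<open>n\<close> indices have a value above \<open>v\<close>, and at least \<open>n\<close> have a value at least \<open>v\<close>.
  In particular \<open>v\<close> is attained. The finiteness clauses are needed because \<open>card\<close> is \<open>0\<close> on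
  infinite sets; the second set is infinite e.g. when \<open>v = 0\<close>.\<close>

definition nth_largest_value :: "'i set \<Rightarrow> ('i \<Rightarrow> real) \<Rightarrow> nat \<Rightarrow> real \<Rightarrow> bool" where
  "nth_largest_value I f n v \<longleftrightarrow>
     finite {i \<in> I. f i > v} \<and> card {i \<in> I. f i > v} < n \<and>
     (infinite {i \<in> I. f i \<ge> v} \<or> card {i \<in> I. f i \<ge> v} \<ge> n)"

definition nonincreasing_rearrangement :: "'i set \<Rightarrow> ('i \<Rightarrow> real) \<Rightarrow> (nat \<Rightarrow> real) \<Rightarrow> bool" where
  "nonincreasing_rearrangement I f \<tau> \<longleftrightarrow>
     nonincreasing_zero_sequence \<tau> \<and> (\<forall>n\<ge>1. nth_largest_value I f n (\<tau> n))"

end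

theory Submission
  imports Defs
begin

text \<open>
  After scaling we may assume \<open>\<sigma> 1 = 1\<close>; put \<open>r = \<sigma> 2\<close>.

  Upper bound: at least \<open>n\<close> indices have a value \<open>\<ge> v = \<tau> n\<close>, so for every exponent \<open>p\<close> Markov's
  inequality gives \<open>n v\<^sup>p \<le> (1 + \<Sum>m\<ge>2. \<sigma>(m)\<^sup>p)\<^sup>d \<le> exp (d \<Sum>m\<ge>2. \<sigma>(m)\<^sup>p)\<close>. For
  \<open>p = 2/s + ln d / ln (1/r)\<close> we have \<open>\<sigma>(m)\<^sup>p \<le> r\<^bsup>p - 2/s\<^esup> \<sigma>(m)\<^bsup>2/s\<^esup> \<le> C\<^bsup>2/s\<^esup> m\<^sup>-\<^sup>2 / d\<close>, and
  \<open>1/p\<close> is the exponent of the claim.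

  Lower bound: there are \<open>\<Sum>i\<le>l. d choose i\<close> indices in \<open>{1,2}\<^sup>d\<close> with at most \<open>l\<close> entries \<open>2\<close>, and
  their values are at least \<open>r\<^sup>l\<close>. For the least \<open>l\<close> with \<open>\<Sum>i\<le>l. d choose i \<ge> n\<close> and \<open>m = l - 1\<close>,
  we have \<open>n > \<Sum>i\<le>m. d choose i \<ge> (1 + d/m)\<^sup>m\<close>. As this is at least \<open>2\<^sup>m\<close>, also \<open>m \<le> log 2 n\<close>,
  and therefore \<open>n \<ge> (1 + d / log 2 n)\<^sup>m\<close>.
\<close>

section \<open>Largest values of a family of reals\<close>

lemma nth_largest_value_scale:
  assumes "c > 0" "nth_largest_value I f n v"
  shows "nth_largest_value I (\<lambda>i. f i / c) n (v / c)"
  using assms by (simp add: nth_largest_value_def divide_less_cancel divide_le_cancel)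

text \<open>If \<open>v < c\<close>, all of \<open>B\<close> would lie strictly above level
  \<open>v\<close>, where there are fewer than \<open>n\<close> indices.\<close>

lemma nth_largest_value_ge:
  assumes v: "nth_largest_value I f n v"
    and B: "B \<subseteq> I" "n \<le> card B" "\<And>i. i \<in> B \<Longrightarrow> f i \<ge> c"
  shows "v \<ge> c"
proof (rule ccontr)
  assume "\<not> v \<ge> c"
  then have "B \<subseteq> {i \<in> I. f i > v}"
    using B by force
  then have "card B \<le> card {i \<in> I. f i > v}"
    using v by (intro card_mono) (auto simp: nth_largest_value_def)
  then show False
    using v B by (auto simp: nth_largest_value_def)
qed

text \<open>The set of indices at level \<open>v\<close> or above may be infinite, for instance when
  \<open>v = 0\<close>. Fixing exactly \<open>n\<close> of its elements keeps the later sums over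
  indices finite.\<close>

lemma nth_largest_value_obtain:
  assumes "nth_largest_value I f n v"
  obtains B where "finite B" "card B = n" "B \<subseteq> I" "\<And>i. i \<in> B \<Longrightarrow> f i \<ge> v"
proof -
  obtain B where B: "finite B" "card B = n" "B \<subseteq> {i \<in> I. f i \<ge> v}"
  proof (cases "finite {i \<in> I. f i \<ge> v}")
    case True
    then have "n \<le> card {i \<in> I. f i \<ge> v}"
      using assms by (auto simp: nth_largest_value_def)
    then show ?thesis
      by (rule obtain_subset_with_card_n) (rule that)
  next
    case False
    then show ?thesis
      using infinite_arbitrarily_large[of _ n] that by blast
  qed
  then show ?thesis
    using that[of B] by auto
qed

lemma nth_largest_value_1_eq:
  assumes v: "nth_largest_value I f 1 v"
    and k: "k \<in> I" "\<And>i. i \<in> I \<Longrightarrow> f i \<le> f k"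
  shows "v = f k"
proof (rule antisym)
  obtain B where B: "card B = 1" "B \<subseteq> I" "\<And>i. i \<in> B \<Longrightarrow> f i \<ge> v"
    using nth_largest_value_obtain[OF v] by metis
  then obtain i where "i \<in> B"
    by (metis card.empty ex_in_conv zero_neq_one)
  then show "v \<le> f k"
    using B k by force
  show "f k \<le> v"
    by (rule nth_largest_value_ge[OF v, of "{k}"]) (use k in auto)
qed

section \<open>Scaling of tensor powers and sign of the sequence\<close>

lemma tensor_power_scale:
  "tensor_power (\<lambda>m. \<sigma> m / c) d k = tensor_power \<sigma> d k / c ^ d"
  by (simp add: tensor_power_def prod_dividef)

lemma nonincreasing_zero_sequence_nonneg:
  assumes "nonincreasing_zero_sequence \<sigma>" "m \<ge> 1"
  shows "\<sigma> m \<ge> 0"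
proof (rule LIMSEQ_le_const2)
  show "\<sigma> \<longlonglongrightarrow> 0"
    using assms by (simp add: nonincreasing_zero_sequence_def)
  show "\<exists>N. \<forall>k\<ge>N. \<sigma> k \<le> \<sigma> m"
    using assms by (intro exI[of _ m]) (auto simp: nonincreasing_zero_sequence_def monotone_on_def)
qed

section \<open>Lower estimate for partial sums of binomial coefficients\<close>

lemma binomial_ge_ratio:
  assumes "i \<le> m" "m \<le> d"
  shows "real (m choose i) * (real d / real m) ^ i \<le> real (d choose i)"
\<comment> \<open>Here \<open>d / m\<close> is 0 by convention, but \<open>i = 0\<close> as well, so
  both sides are 1.\<close>
proof (cases "m = 0")
  case True
  then show ?thesis using assms by simp
next
  case False
  have eq: "real (a choose i) = (\<Prod>j = 0..<i. real a - real j) / fact i" for a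
    by (simp add: binomial_gbinomial gbinomial_prod_rev)
  have "(\<Prod>j = 0..<i. real m - real j) * (real d / real m) ^ i
      = (\<Prod>j = 0..<i. (real m - real j) * (real d / real m))"
    by (simp only: prod.distrib prod_constant card_atLeastLessThan diff_zero)
  also have "\<dots> \<le> (\<Prod>j = 0..<i. real d - real j)"
  proof (rule prod_mono, intro conjI)
    fix j assume j: "j \<in> {0..<i}"
    then show "0 \<le> (real m - real j) * (real d / real m)"
      using assms by auto
    \<comment> \<open>Clearing the denominator \<open>m\<close>, this is all that the comparison of
      the \<open>j\<close>th factors needs.\<close>
    have "real j * real m \<le> real j * real d"
      using assms by (intro mult_left_mono) auto
    then show "(real m - real j) * (real d / real m) \<le> real d - real j"
      using False by (simp add: field_simps)
  qed
  finally show ?thesis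
    unfolding eq by (simp add: divide_right_mono)
qed

lemma sum_binomial_ge:
  assumes "m \<le> d"
  shows "(1 + real d / real m) ^ m \<le> (\<Sum>i\<le>m. real (d choose i))"
proof -
  have "(1 + real d / real m) ^ m = (\<Sum>i\<le>m. real (m choose i) * (real d / real m) ^ i)"
    using binomial_ring[of "real d / real m" 1 m] by (simp add: add.commute)
  also have "\<dots> \<le> (\<Sum>i\<le>m. real (d choose i))"
    using assms by (intro sum_mono binomial_ge_ratio) auto
  finally show ?thesis .
qed

section \<open>Lower bound: indices with entries 1 and 2\<close>

lemma card_subsets_card_le:
  assumes "finite A"
  shows "card {S. S \<subseteq> A \<and> card S \<le> l} = (\<Sum>i\<le>l. card A choose i)"
proof -
  have "{S. S \<subseteq> A \<and> card S \<le> l} = (\<Union>i\<in>{..l}. {S. S \<subseteq> A \<and> card S = i})"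
    by auto
  also have "card \<dots> = (\<Sum>i\<le>l. card {S. S \<subseteq> A \<and> card S = i})"
    using assms by (intro card_UN_disjoint) (auto intro: finite_subset[OF _ finite_Pow_iff[THEN iffD2]])
  finally show ?thesis
    using assms by (simp add: n_subsets)
qed

text \<open>A set \<open>S\<close> of at most \<open>l\<close> positions yields the index
  \<open>h S\<close> with entry 2 exactly on \<open>S\<close>. Its value is
  \<open>\<sigma> 2 ^ card S\<close>, and \<open>S\<close> can be recovered from it, so there are
  enough such indices.\<close>

lemma rearrangement_ge_power:
  fixes \<sigma> :: "nat \<Rightarrow> real"
  assumes v: "nth_largest_value (multi_indices d) (tensor_power \<sigma> d) n v"
    and \<sigma>: "\<sigma> 1 = 1" "0 < \<sigma> 2" "\<sigma> 2 \<le> 1"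
    and n: "n \<le> (\<Sum>i\<le>l. d choose i)"
  shows "\<sigma> 2 ^ l \<le> v"
proof -
  define h :: "nat set \<Rightarrow> nat \<Rightarrow> nat"
    where "h S = restrict (\<lambda>j. if j \<in> S then 2 else 1) {1..d}" for S
  define F where "F = {S. S \<subseteq> {1..d} \<and> card S \<le> l}"
  have "inj_on h F"
  proof (rule inj_onI)
    fix S T assume ST: "S \<in> F" "T \<in> F" and eq: "h S = h T"
    have "S = {j \<in> {1..d}. h S j = 2}" "T = {j \<in> {1..d}. h T j = 2}"
      using ST by (auto simp: F_def h_def)
    then show "S = T"
      using eq by simp
  qed
  then have "card (h ` F) = (\<Sum>i\<le>l. d choose i)"
    by (simp add: card_image F_def card_subsets_card_le)
  moreover have "tensor_power \<sigma> d k \<ge> \<sigma> 2 ^ l" if kF: "k \<in> h ` F" for k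
  proof -
    obtain S where S: "S \<subseteq> {1..d}" "card S \<le> l" and k: "k = h S"
      using kF by (auto simp: F_def)
    have "tensor_power \<sigma> d k = (\<Prod>j=1..d. if j \<in> S then \<sigma> 2 else 1)"
      unfolding tensor_power_def k using \<sigma> by (intro prod.cong) (auto simp: h_def)
    also have "\<dots> = \<sigma> 2 ^ card S"
      using S by (simp add: prod.If_cases Int_absorb1)
    finally show ?thesis
      using S \<sigma> by (simp add: power_decreasing)
  qed
  ultimately show ?thesis
    using n by (intro nth_largest_value_ge[OF v, of "h ` F"]) (auto simp: h_def multi_indices_def)
qed

lemma log_bound_of_sum_binomial_less:
  assumes n: "(\<Sum>i\<le>m. d choose i) < n" and m: "m \<le> d" and d: "d \<ge> 1"
  shows "real m \<le> ln n / ln (1 + real d / log 2 n)"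
proof (cases "m = 0")
  case True
  \<comment> \<open>The claim is only that the quotient of logarithms is nonnegative, which follows
    from \<open>n \<ge> 2\<close>.\<close>
  have "1 \<le> (\<Sum>i\<le>m. d choose i)"
    by (simp add: True)
  with n have "n \<ge> 2" by linarith
  then have "log 2 n > 0" by simp
  then show ?thesis
    using True \<open>n \<ge> 2\<close> d by simp
next
  case False
  have "(1 + real d / real m) ^ m < real n"
    using sum_binomial_ge[OF m] n by (simp flip: of_nat_sum)
  \<comment> \<open>Since \<open>m \<le> d\<close>, the base on the right is at least 2.\<close>
  moreover have "2 ^ m \<le> (1 + real d / real m) ^ m"
    using False m by (intro power_mono) auto
  ultimately have pow: "2 ^ m < real n" "(1 + real d / real m) ^ m < real n"
    by linarith+
  have "n > 0" using n by simp
  then have mlog: "real m \<le> log 2 n"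
    using pow(1) by (simp add: le_log_iff powr_realpow)
  then have pos: "log 2 n > 0" using False by linarith
  have "1 + real d / log 2 n \<le> 1 + real d / real m"
    using mlog pos False by (simp add: divide_left_mono)
  then have "(1 + real d / log 2 n) ^ m \<le> (1 + real d / real m) ^ m"
    using pos by (intro power_mono) auto
  with pow(2) have "(1 + real d / log 2 n) ^ m \<le> real n"
    by linarith
  moreover have gt1: "1 + real d / log 2 n > 1"
    using pos d by simp
  ultimately have "real m * ln (1 + real d / log 2 n) \<le> ln n"
    by (metis ln_mono ln_realpow less_trans zero_less_one zero_less_power)
  then show ?thesis
    using gt1 by (simp add: pos_le_divide_eq)
qed

lemma rearrangement_lower_bound:
  fixes \<sigma> :: "nat \<Rightarrow> real"
  assumes d: "d \<ge> 1"
    and v: "nth_largest_value (multi_indices d) (tensor_power \<sigma> d) n v"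
    and \<sigma>: "\<sigma> 1 = 1" "0 < \<sigma> 2" "\<sigma> 2 < 1"
    and n: "n \<in> {2..2 ^ d}"
  shows "\<sigma> 2 * (1 / real n) powr (ln (1 / \<sigma> 2) / ln (1 + real d / log 2 n)) \<le> v"
proof -
  define P where "P l \<longleftrightarrow> n \<le> (\<Sum>i\<le>l. d choose i)" for l
  define l where "l = (LEAST l. P l)"
  \<comment> \<open>The whole row sums to \<open>2 ^ d\<close>; this is where the upper limit on
    \<open>n\<close> enters.\<close>
  have Pd: "P d"
    using n by (simp add: P_def choose_row_sum)
  then have Pl: "P l" and ld: "l \<le> d"
    unfolding l_def by (auto intro: LeastI Least_le)
  have "\<not> P 0"
    using n by (simp add: P_def)
  with Pl obtain m where m: "l = Suc m"
    by (cases l) auto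
  then have "\<not> P m"
    unfolding l_def by (metis lessI not_less_Least)
  then have "real m \<le> ln n / ln (1 + real d / log 2 n)"
    using d ld m by (intro log_bound_of_sum_binomial_less) (auto simp: P_def)
  then have "\<sigma> 2 powr (ln n / ln (1 + real d / log 2 n)) \<le> \<sigma> 2 powr real m"
    using \<sigma> by (intro powr_mono') auto
  moreover have "(1 / real n) powr (ln (1 / \<sigma> 2) / ln (1 + real d / log 2 n))
      = \<sigma> 2 powr (ln n / ln (1 + real d / log 2 n))"
    using \<sigma> n by (simp add: powr_def ln_div)
  \<comment> \<open>The leading factor \<open>\<sigma> 2\<close> pays for the step from
    \<open>m\<close> to \<open>l = Suc m\<close>.\<close>
  ultimately have "\<sigma> 2 * (1 / real n) powr (ln (1 / \<sigma> 2) / ln (1 + real d / log 2 n))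
      \<le> \<sigma> 2 ^ l"
    using \<sigma> by (simp add: m powr_realpow)
  also have "\<dots> \<le> v"
    using rearrangement_ge_power[OF v] \<sigma> Pl by (simp add: P_def)
  finally show ?thesis .
qed

section \<open>Upper bound: power sums and Markov's inequality\<close>

lemma sum_inverse_squares_le: "(\<Sum>m=2..M. 1 / (real m)\<^sup>2) \<le> 1"
proof -
  have "(\<Sum>m=2..Suc N. 1 / (real m)\<^sup>2) \<le> 1 - 1 / real (Suc N)" for N
  proof (induction N)
    case (Suc N)
    \<comment> \<open>These differences telescope.\<close>
    have "1 / (real (Suc (Suc N)))\<^sup>2 \<le> 1 / real (Suc N) - 1 / real (Suc (Suc N))"
      by (simp add: divide_simps power2_eq_square)
    with Suc show ?case by simp
  qed simp
  from this[of "M - 1"] show ?thesis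
    by (cases M) (auto intro: order_trans)
qed

text \<open>The entries of the finitely many indices in \<open>B\<close> are bounded by some
  \<open>M\<close>. Over the box of all indices with entries up to \<open>M\<close>, the sum of the
  \<open>p\<close>th powers factorises into \<open>d\<close> equal sums, so no infinite series
  occurs.\<close>

lemma markov_tensor_power:
  fixes \<sigma> :: "nat \<Rightarrow> real"
  assumes B: "finite B" "B \<subseteq> multi_indices d" "\<And>k. k \<in> B \<Longrightarrow> tensor_power \<sigma> d k \<ge> v"
    and v: "v \<ge> 0" and p: "p \<ge> 0"
    and S: "\<And>M. (\<Sum>m=1..M. \<sigma> m powr p) \<le> S"
  shows "real (card B) * v powr p \<le> S ^ d"
proof -
  obtain M where M: "\<And>k j. k \<in> B \<Longrightarrow> j \<in> {1..d} \<Longrightarrow> k j \<le> M"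
  proof -
    let ?V = "\<Union>k\<in>B. k ` {1..d}"
    have "finite ?V" using B by auto
    then have "k j \<le> Max ?V" if "k \<in> B" "j \<in> {1..d}" for k j
      using that by (intro Max_ge UN_I[of k] imageI)
    then show ?thesis using that by blast
  qed
  have sub: "B \<subseteq> {1..d} \<rightarrow>\<^sub>E {1..M}"
  proof
    fix k assume k: "k \<in> B"
    then have "k \<in> {1..d} \<rightarrow>\<^sub>E {1..}"
      using B by (auto simp: multi_indices_def)
    then show "k \<in> {1..d} \<rightarrow>\<^sub>E {1..M}"
      using M[OF k] by (fastforce simp: PiE_iff)
  qed
  have "real (card B) * v powr p = (\<Sum>k\<in>B. v powr p)"
    by simp
  also have "\<dots> \<le> (\<Sum>k\<in>B. tensor_power \<sigma> d k powr p)"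
    using B v p by (intro sum_mono powr_mono2) auto
  also have "\<dots> \<le> (\<Sum>k\<in>{1..d} \<rightarrow>\<^sub>E {1..M}. tensor_power \<sigma> d k powr p)"
    using sub by (intro sum_mono2) (auto intro: finite_PiE)
  also have "\<dots> = (\<Prod>j\<in>{1..d}. \<Sum>m=1..M. \<sigma> m powr p)"
    unfolding tensor_power_def prod_powr_distrib by (rule prod_sum_PiE[symmetric]) auto
  also have "\<dots> \<le> S ^ d"
    using S[of M] by (simp add: prod_constant power_mono sum_nonneg)
  finally show ?thesis .
qed

lemma sum_powr_le:
  fixes \<sigma> :: "nat \<Rightarrow> real" and d :: nat
  assumes d: "d \<ge> 1"
    and \<sigma>: "\<sigma> 1 = 1" "0 < \<sigma> 2" "\<sigma> 2 < 1" "\<And>m. m \<ge> 2 \<Longrightarrow> 0 \<le> \<sigma> m \<and> \<sigma> m \<le> \<sigma> 2"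
    and s: "s > 0" and C: "C > 0" and le: "\<And>m. m \<ge> 2 \<Longrightarrow> \<sigma> m \<le> C * real m powr (- s)"
  shows "(\<Sum>m=1..M. \<sigma> m powr (2 / s + ln d / ln (1 / \<sigma> 2))) \<le> 1 + C powr (2 / s) / d"
proof -
  let ?q = "ln d / ln (1 / \<sigma> 2)"
  have q: "?q \<ge> 0"
    using \<sigma> d by (intro divide_nonneg_nonneg) auto
  \<comment> \<open>The exponent \<open>?q\<close> is chosen to make this true; the remaining
    \<open>2 / s\<close> turns the decay \<open>m powr (- s)\<close> into the summable
    \<open>m powr (- 2)\<close>.\<close>
  have rq: "\<sigma> 2 powr ?q = 1 / d"
    using \<sigma> d by (simp add: powr_def ln_div exp_minus inverse_eq_divide)
  have term_le: "\<sigma> m powr (2 / s + ?q) \<le> C powr (2 / s) / d * (1 / (real m)\<^sup>2)" if m: "m \<ge> 2" for m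
  proof -
    have "\<sigma> m powr (2 / s) \<le> (C * real m powr (- s)) powr (2 / s)"
      using \<sigma>(4)[OF m] le[OF m] s by (intro powr_mono2) auto
    also have "\<dots> = C powr (2 / s) * real m powr (- 2)"
      using C s by (simp add: powr_mult powr_powr)
    also have "\<dots> = C powr (2 / s) * (1 / (real m)\<^sup>2)"
      using m by (simp add: powr_minus_divide powr_numeral)
    finally have "\<sigma> m powr (2 / s) \<le> C powr (2 / s) * (1 / (real m)\<^sup>2)" .
    moreover have "\<sigma> m powr ?q \<le> 1 / d"
      using powr_mono2[OF q, of "\<sigma> m" "\<sigma> 2"] \<sigma>(4)[OF m] rq by simp
    ultimately have "\<sigma> m powr (2 / s) * \<sigma> m powr ?q \<le> C powr (2 / s) * (1 / (real m)\<^sup>2) * (1 / d)"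
      by (intro mult_mono) auto
    then show ?thesis by (simp add: powr_add mult_ac)
  qed
  \<comment> \<open>The first term is 1. Equality fails for \<open>M = 0\<close>, where both sums
    are empty.\<close>
  have "(\<Sum>m=1..M. \<sigma> m powr (2 / s + ?q)) \<le> 1 + (\<Sum>m=2..M. \<sigma> m powr (2 / s + ?q))"
  proof (cases "M \<ge> 1")
    case True
    then show ?thesis
      using sum.atLeast_Suc_atMost[of 1 M "\<lambda>m. \<sigma> m powr (2 / s + ?q)"] \<sigma>(1)
      by (simp del: One_nat_def add: Suc_1)
  qed simp
  also have "(\<Sum>m=2..M. \<sigma> m powr (2 / s + ?q)) \<le> (\<Sum>m=2..M. C powr (2 / s) / d * (1 / (real m)\<^sup>2))"
    by (intro sum_mono term_le) auto
  also have "\<dots> = C powr (2 / s) / d * (\<Sum>m=2..M. 1 / (real m)\<^sup>2)"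
    by (rule sum_distrib_left[symmetric])
  also have "\<dots> \<le> C powr (2 / s) / d * 1"
    by (intro mult_left_mono sum_inverse_squares_le) auto
  finally show ?thesis by simp
qed

lemma rearrangement_upper_bound:
  fixes \<sigma> :: "nat \<Rightarrow> real"
  assumes d: "d \<ge> 1"
    and v: "nth_largest_value (multi_indices d) (tensor_power \<sigma> d) n v" "v \<ge> 0"
    and \<sigma>: "\<sigma> 1 = 1" "0 < \<sigma> 2" "\<sigma> 2 < 1" "\<And>m. m \<ge> 2 \<Longrightarrow> 0 \<le> \<sigma> m \<and> \<sigma> m \<le> \<sigma> 2"
    and s: "s > 0" and C: "C > 0" and le: "\<And>m. m \<ge> 2 \<Longrightarrow> \<sigma> m \<le> C * real m powr (- s)"
    and n: "n \<ge> 1"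
  shows "v \<le> (exp (C powr (2 / s)) / real n) powr
               (ln (1 / \<sigma> 2) / ln ((1 / \<sigma> 2) powr (2 / s) * real d))"
proof -
  define p where "p = 2 / s + ln d / ln (1 / \<sigma> 2)"
  have lnpos: "ln (1 / \<sigma> 2) > 0"
    using \<sigma> by simp
  have "ln d / ln (1 / \<sigma> 2) \<ge> 0"
    using lnpos d by simp
  then have p: "p > 0"
    using s by (simp add: p_def add_pos_nonneg)
  obtain B where B: "finite B" "card B = n" "B \<subseteq> multi_indices d"
      "\<And>k. k \<in> B \<Longrightarrow> tensor_power \<sigma> d k \<ge> v"
    using nth_largest_value_obtain[OF v(1)] by metis
  have S: "(\<Sum>m=1..M. \<sigma> m powr p) \<le> 1 + C powr (2 / s) / d" for M
    unfolding p_def by (rule sum_powr_le) (use d \<sigma> s C le in auto)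
  have "real n * v powr p \<le> (1 + C powr (2 / s) / d) ^ d"
    using markov_tensor_power[OF B(1,3,4) v(2) _ S] p B(2) by simp
  \<comment> \<open>The factor \<open>1 / d\<close> gained in the power sum now cancels against the
    \<open>d\<close>th power.\<close>
  also have "\<dots> \<le> exp (C powr (2 / s) / d) ^ d"
    by (intro power_mono exp_ge_add_one_self) simp
  also have "\<dots> = exp (C powr (2 / s))"
    using d by (simp flip: exp_of_nat_mult)
  finally have "v powr p \<le> exp (C powr (2 / s)) / n"
    using n by (simp add: field_simps)
  then have "(v powr p) powr (1 / p) \<le> (exp (C powr (2 / s)) / n) powr (1 / p)"
    using p by (intro powr_mono2) auto
  moreover have "(v powr p) powr (1 / p) = v"
    using p v(2) by (simp add: powr_powr)
  moreover have "1 / p = ln (1 / \<sigma> 2) / ln ((1 / \<sigma> 2) powr (2 / s) * real d)"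
  proof -
    have "ln ((1 / \<sigma> 2) powr (2 / s) * real d) = 2 / s * ln (1 / \<sigma> 2) + ln d"
      using \<sigma> d by (simp add: ln_mult ln_powr)
    also have "\<dots> = p * ln (1 / \<sigma> 2)"
      using lnpos by (simp add: p_def distrib_right)
    finally show ?thesis
      using lnpos by simp
  qed
  ultimately show ?thesis by simp
qed

section \<open>Reduction to first term 1\<close>

theorem theorem3:
  fixes \<sigma> \<tau> :: "nat \<Rightarrow> real" and d n :: nat and s C :: real
  assumes "d \<ge> 1"
    and "nonincreasing_zero_sequence \<sigma>"
    and "nonincreasing_rearrangement (multi_indices d) (tensor_power \<sigma> d) \<tau>"
    and "\<sigma> 1 > \<sigma> 2" and "\<sigma> 2 > 0"
    and "s > 0" and "C > 0"
    and "\<And>m. m \<ge> 2 \<Longrightarrow> \<sigma> m \<le> C * real m powr (- s)"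
    and "n \<in> {2..2 ^ d}"
  shows "\<sigma> 2 / \<sigma> 1 * (1 / real n) powr
             (ln (\<sigma> 1 / \<sigma> 2) / ln (1 + real d / log 2 (real n)))
           \<le> \<tau> n / \<tau> 1
       \<and> \<tau> n / \<tau> 1
           \<le> (exp ((C / \<sigma> 1) powr (2 / s)) / real n) powr
             (ln (\<sigma> 1 / \<sigma> 2) / ln ((\<sigma> 1 / \<sigma> 2) powr (2 / s) * real d))"
proof -
  define \<rho> where "\<rho> m = \<sigma> m / \<sigma> 1" for m
  have \<sigma>1: "\<sigma> 1 > 0"
    using assms by linarith
  have mono: "\<sigma> b \<le> \<sigma> a" if "1 \<le> a" "a \<le> b" for a b
    using assms(2) that by (auto simp: nonincreasing_zero_sequence_def monotone_on_def)
  have nonneg: "\<sigma> m \<ge> 0" if "m \<ge> 1" for m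
    using nonincreasing_zero_sequence_nonneg[OF assms(2) that] .
  have largest: "nth_largest_value (multi_indices d) (tensor_power \<sigma> d) m (\<tau> m)" if "m \<ge> 1" for m
    using assms(3) that by (simp add: nonincreasing_rearrangement_def)
  \<comment> \<open>The all-ones index maximises the tensor power, as \<open>\<sigma>\<close> is
    nonincreasing and nonnegative; this evaluates \<open>\<tau> 1\<close>.\<close>
  define e :: "nat \<Rightarrow> nat" where "e = restrict (\<lambda>_. 1) {1..d}"
  have e: "tensor_power \<sigma> d e = \<sigma> 1 ^ d"
    by (simp add: tensor_power_def e_def)
  have "tensor_power \<sigma> d k \<le> tensor_power \<sigma> d e" if "k \<in> multi_indices d" for k
    unfolding tensor_power_def using that
    by (intro prod_mono) (force simp: e_def multi_indices_def PiE_iff intro: mono nonneg)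
  then have \<tau>1: "\<tau> 1 = \<sigma> 1 ^ d"
    using nth_largest_value_1_eq[OF largest, of e] e by (auto simp: e_def multi_indices_def)
  have v: "nth_largest_value (multi_indices d) (tensor_power \<rho> d) n (\<tau> n / \<tau> 1)"
  proof -
    have "tensor_power \<rho> d = (\<lambda>k. tensor_power \<sigma> d k / \<sigma> 1 ^ d)"
      unfolding \<rho>_def by (simp add: fun_eq_iff tensor_power_scale)
    then show ?thesis
      unfolding \<tau>1
      using nth_largest_value_scale[OF _ largest, of "\<sigma> 1 ^ d" n] \<sigma>1 assms(9) by simp
  qed
  have \<rho>: "\<rho> 1 = 1" "0 < \<rho> 2" "\<rho> 2 < 1" "\<And>m. m \<ge> 2 \<Longrightarrow> 0 \<le> \<rho> m \<and> \<rho> m \<le> \<rho> 2"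
    using assms \<sigma>1 mono nonneg by (auto simp: \<rho>_def divide_right_mono)
  have ratio: "\<sigma> 1 / \<sigma> 2 = 1 / \<rho> 2" "\<sigma> 2 / \<sigma> 1 = \<rho> 2"
    by (auto simp: \<rho>_def)
  have lower: "\<rho> 2 * (1 / real n) powr (ln (1 / \<rho> 2) / ln (1 + real d / log 2 n)) \<le> \<tau> n / \<tau> 1"
    using rearrangement_lower_bound[OF assms(1) v \<rho>(1-3) assms(9)] .
  have decay: "\<rho> m \<le> C / \<sigma> 1 * real m powr (- s)" if "m \<ge> 2" for m
    using assms(8)[OF that] \<sigma>1 by (simp add: \<rho>_def divide_right_mono)
  \<comment> \<open>The upper bound requires a nonnegative value, and the lower bound just proved
    supplies it.\<close>
  have "0 \<le> \<tau> n / \<tau> 1"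
    using lower \<rho>(2) by (meson order_trans less_imp_le mult_nonneg_nonneg powr_ge_zero)
  then have "\<tau> n / \<tau> 1 \<le> (exp ((C / \<sigma> 1) powr (2 / s)) / real n) powr
               (ln (1 / \<rho> 2) / ln ((1 / \<rho> 2) powr (2 / s) * real d))"
    using \<sigma>1 assms \<rho> decay by (intro rearrangement_upper_bound[OF _ v]) auto
  with lower show ?thesis
    unfolding ratio by blast
qed

end
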